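(* Let $X$ be an Archimedean vector lattice with a strictly positive linear functional $x_0^*$. Let $\widetilde X$ be the norm completion of $(X,\|\cdot\|_L)$, where $\|x\|_L=x_0^*(|x|)$ for $x\in X$. The following four statements are equivalent: (1) $x_0^*$ is order continuous on $X$; (2) $X$ is a regular sublattice of $\widetilde X$; (3) $X$ is an order dense sublattice of $\widetilde X$; (4) for any net $(x_\alpha)$ in $X$, $x_\alpha\xrightarrow{\rm uo}0$ in $X$ if and only if $x_\alpha\xrightarrow{\rm uo}0$ in $\widetilde X$. If, in addition, $X$ is order complete, then (1)--(4) are equivalent to: (5) $X$ is an ideal in $\widetilde X$.
   Context: All vector lattices are real and Archimedean. A linear functional $x_0^*$ on $X$ is strictly positive if $x_0^*(x)>0$ for every $x>0$ in $X$. Then $\|\cdot\|_L$ is a lattice norm on $X$, and its completion $\widetilde X$ is an AL-space (a Banach lattice whose norm is additive on the positive cone) in which $X$ is a norm dense sublattice. A sublattice $Y$ of $Z$ is regular if for every subset $A$ of $Y$ whose infimum exists in $Y$, the infimum of $A$ exists in $Z$ and equals the infimum in $Y$; it is order dense if for every $0<z\in Z$ there is $y\in Y$ with $0<y\le z$. A net $(x_\alpha)_{\alpha\in\Gamma}$ in a vector lattice $Z$ converges in order to $x\in Z$ ($x_\alpha\xrightarrow{\rm o}x$) if there is a net $(a_\gamma)_{\gamma\in\Lambda}$ in $Z$ (possibly over a different index set) with $a_\gamma\downarrow 0$ in $Z$ such that for every $\gamma\in\Lambda$ there is $\alpha_0\in\Gamma$ with $|x_\alpha-x|\le a_\gamma$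 for all $\alpha\ge\alpha_0$. It uo-converges to $x$ in $Z$ ($x_\alpha\xrightarrow{\rm uo}x$) if $|x_\alpha-x|\wedge z\xrightarrow{\rm o}0$ in $Z$ for every $z\in Z_+$. A functional is order continuous if it maps order null nets to null nets. *)

theory Defs
  imports "HOL-Analysis.Analysis" "HOL-Library.Lattice_Algebras" "HOL-Library.Lub_Glb"
begin

section \<open>Vector lattices and Banach lattices\<close>

class vector_lattice = ordered_real_vector + lattice_ab_group_add_abs

class archimedean_vector_lattice = vector_lattice +
  assumes archimedean: "(\<And>n::nat. real n *\<^sub>R x \<le> y) \<Longrightarrow> x \<le> 0"

text \<open>No Archimedean axiom is listed for Banach lattices: it follows from the other axioms
  (see \<open>banach_lattice_archimedean\<close> below).\<close>

class banach_lattice = vector_lattice + banach +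
  assumes norm_mono_abs: "\<bar>x\<bar> \<le> \<bar>y\<bar> \<Longrightarrow> norm x \<le> norm y"

definition vector_sublattice :: "'z::vector_lattice set \<Rightarrow> bool" where
  "vector_sublattice Y \<longleftrightarrow>
     subspace Y \<and> (\<forall>x\<in>Y. \<forall>y\<in>Y. sup x y \<in> Y \<and> inf x y \<in> Y)"

text \<open>\<open>isGlb Y A y\<close> says that \<open>y\<close> is the infimum of \<open>A\<close> computed in the ordered set \<open>Y\<close>.\<close>

definition regular_sublattice :: "'z::vector_lattice set \<Rightarrow> bool" where
  "regular_sublattice Y \<longleftrightarrow>
     vector_sublattice Y \<and> (\<forall>A y. A \<subseteq> Y \<longrightarrow> isGlb Y A y \<longrightarrow> isGlb UNIV A y)"

definition order_dense_sublattice :: "'z::vector_lattice set \<Rightarrow> bool" where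
  "order_dense_sublattice Y \<longleftrightarrow>
     vector_sublattice Y \<and> (\<forall>z>0. \<exists>y\<in>Y. 0 < y \<and> y \<le> z)"

definition order_ideal :: "'z::vector_lattice set \<Rightarrow> bool" where
  "order_ideal Y \<longleftrightarrow> subspace Y \<and> (\<forall>y\<in>Y. \<forall>z. \<bar>z\<bar> \<le> \<bar>y\<bar> \<longrightarrow> z \<in> Y)"

definition order_complete :: "'x::vector_lattice itself \<Rightarrow> bool" where
  "order_complete _ \<longleftrightarrow>
     (\<forall>A::'x set. A \<noteq> {} \<longrightarrow> bdd_above A \<longrightarrow> (\<exists>s. isLub UNIV A s))"

definition lattice_homomorphism :: "('x::vector_lattice \<Rightarrow> 'z::vector_lattice) \<Rightarrow> bool" where
  "lattice_homomorphism J \<longleftrightarrow>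
     linear J \<and> (\<forall>x y. J (sup x y) = sup (J x) (J y) \<and> J (inf x y) = inf (J x) (J y))"


section \<open>Strictly positive functionals and the norm completion\<close>

definition strictly_positive :: "('x::vector_lattice \<Rightarrow> real) \<Rightarrow> bool" where
  "strictly_positive f \<longleftrightarrow> (\<forall>x>0. f x > 0)"

definition L_norm :: "('x::vector_lattice \<Rightarrow> real) \<Rightarrow> 'x \<Rightarrow> real" where
  "L_norm f x = f \<bar>x\<bar>"

text \<open>
  The completion of a lattice-normed vector lattice is determined up to isometric lattice
  isomorphism. It is represented by a Banach lattice \<open>'z\<close> together with its canonical
  embedding \<open>J\<close>, so that \<open>X\<close> as a subset of its completion is \<open>range J\<close>. A type
  constructed from \<open>'x\<close> and \<open>N\<close> is not available, since a type cannot depend on the term \<open>N\<close>.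
\<close>

definition norm_completion ::
    "('x::vector_lattice \<Rightarrow> real) \<Rightarrow> ('x \<Rightarrow> 'z::banach_lattice) \<Rightarrow> bool" where
  "norm_completion N J \<longleftrightarrow>
     lattice_homomorphism J \<and> (\<forall>x. norm (J x) = N x) \<and> closure (range J) = UNIV"


section \<open>Nets\<close>

text \<open>A net is a map \<open>x\<close> restricted to a directed set: a carrier \<open>\<Gamma>\<close> with a preorder \<open>r\<close> on it,
  where \<open>r \<alpha> \<beta>\<close> reads \<open>\<alpha> \<le> \<beta>\<close>.\<close>

definition directed_set :: "'i set \<Rightarrow> ('i \<Rightarrow> 'i \<Rightarrow> bool) \<Rightarrow> bool" where
  "directed_set \<Gamma> r \<longleftrightarrow>
     \<Gamma> \<noteq> {} \<and> reflp_on \<Gamma> r \<and> transp_on \<Gamma> r \<and> (\<forall>\<alpha>\<in>\<Gamma>. \<forall>\<beta>\<in>\<Gamma>. \<exists>\<gamma>\<in>\<Gamma>. r \<alpha> \<gamma> \<and> r \<beta> \<gamma>)"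

definition net_filter :: "'i set \<Rightarrow> ('i \<Rightarrow> 'i \<Rightarrow> bool) \<Rightarrow> 'i filter" where
  "net_filter \<Gamma> r = (INF \<alpha>\<in>\<Gamma>. principal {\<beta>\<in>\<Gamma>. r \<alpha> \<beta>})"

definition decreases_to_zero ::
    "'j set \<Rightarrow> ('j \<Rightarrow> 'j \<Rightarrow> bool) \<Rightarrow> ('j \<Rightarrow> 'z::vector_lattice) \<Rightarrow> bool" where
  "decreases_to_zero \<Lambda> s a \<longleftrightarrow> monotone_on \<Lambda> s (\<ge>) a \<and> isGlb UNIV (a ` \<Lambda>) 0"

text \<open>The index set of the dominating net \<open>a\<close> ranges over subsets of the lattice itself. This
  loses nothing, as a decreasing net may be reindexed by its range
  (see \<open>order_convI\<close> below).\<close>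

definition order_conv ::
    "'i set \<Rightarrow> ('i \<Rightarrow> 'i \<Rightarrow> bool) \<Rightarrow> ('i \<Rightarrow> 'z::vector_lattice) \<Rightarrow> 'z \<Rightarrow> bool" where
  "order_conv \<Gamma> r x l \<longleftrightarrow>
     (\<exists>(\<Lambda>::'z set) s (a::'z \<Rightarrow> 'z).
        directed_set \<Lambda> s \<and> decreases_to_zero \<Lambda> s a \<and>
        (\<forall>\<gamma>\<in>\<Lambda>. \<exists>\<alpha>\<^sub>0\<in>\<Gamma>. \<forall>\<alpha>\<in>\<Gamma>. r \<alpha>\<^sub>0 \<alpha> \<longrightarrow> \<bar>x \<alpha> - l\<bar> \<le> a \<gamma>))"

definition uo_conv ::
    "'i set \<Rightarrow> ('i \<Rightarrow> 'i \<Rightarrow> bool) \<Rightarrow> ('i \<Rightarrow> 'z::vector_lattice) \<Rightarrow> 'z \<Rightarrow> bool" where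
  "uo_conv \<Gamma> r x l \<longleftrightarrow> (\<forall>z\<ge>0. order_conv \<Gamma> r (\<lambda>\<alpha>. inf \<bar>x \<alpha> - l\<bar> z) 0)"

text \<open>
  HOL has no quantification over types inside a formula, so the type from which the index sets
  of nets are drawn is a parameter. For functionals on \<open>'x\<close> it is used at \<open>'i + 'x\<close> with \<open>'i\<close>
  a free type variable: every net indexed in \<open>'i\<close> is covered through \<open>Inl\<close>
  (\<open>order_conv_Inl\<close>), and the summand \<open>'x\<close> guarantees that nets indexed by subsets of the
  lattice are available, however small \<open>'i\<close> is.
\<close>

definition order_continuous :: "'i itself \<Rightarrow> ('x::vector_lattice \<Rightarrow> real) \<Rightarrow> bool" where
  "order_continuous _ f \<longleftrightarrow>
     (\<forall>(\<Gamma>::'i set) r x. directed_set \<Gamma> r \<longrightarrow> order_conv \<Gamma> r x 0 \<longrightarrow>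
        ((\<lambda>\<alpha>. f (x \<alpha>)) \<longlongrightarrow> 0) (net_filter \<Gamma> r))"


section \<open>Justification of the encodings\<close>

lemma banach_lattice_archimedean:
  fixes x y :: "'z::banach_lattice"
  assumes le: "\<And>n::nat. real n *\<^sub>R x \<le> y"
  shows "x \<le> 0"
proof -
  define p where "p = sup x 0"
  have p0: "0 \<le> p" by (simp add: p_def)
  have b: "real n *\<^sub>R p \<le> sup y 0" for n
  proof (cases "n = 0")
    case False
    then have n: "real n > 0" by simp
    have "x \<le> inverse (real n) *\<^sub>R sup y 0"
    proof -
      have "inverse (real n) *\<^sub>R (real n *\<^sub>R x) \<le> inverse (real n) *\<^sub>R sup y 0"
        using n le[of n] by (intro scaleR_left_mono) (auto intro: le_supI1)
      then show ?thesis using n by simp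
    qed
    moreover have "0 \<le> inverse (real n) *\<^sub>R sup y 0"
      using n by (intro scaleR_nonneg_nonneg) auto
    ultimately have "p \<le> inverse (real n) *\<^sub>R sup y 0" by (simp add: p_def)
    then have "real n *\<^sub>R p \<le> real n *\<^sub>R (inverse (real n) *\<^sub>R sup y 0)"
      using n by (intro scaleR_left_mono) auto
    then show ?thesis using n by simp
  qed auto
  have "real n * norm p \<le> norm (sup y 0)" for n
  proof -
    have "0 \<le> real n *\<^sub>R p" using p0 by (intro scaleR_nonneg_nonneg) auto
    then have "\<bar>real n *\<^sub>R p\<bar> \<le> \<bar>sup y 0\<bar>" using b[of n] by (simp add: abs_of_nonneg)
    from norm_mono_abs[OF this] show ?thesis by simp
  qed
  then have "norm p \<le> 0"
    by (metis not_le reals_Archimedean3)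
  then have "p = 0" by simp
  then show ?thesis unfolding p_def by (metis sup.cobounded1)
qed

lemma eventually_net_filter:
  assumes "directed_set \<Gamma> r"
  shows "eventually P (net_filter \<Gamma> r) \<longleftrightarrow> (\<exists>\<alpha>\<^sub>0\<in>\<Gamma>. \<forall>\<alpha>\<in>\<Gamma>. r \<alpha>\<^sub>0 \<alpha> \<longrightarrow> P \<alpha>)"
proof -
  have "\<exists>c\<in>\<Gamma>. principal {\<beta>\<in>\<Gamma>. r c \<beta>} \<le>
      inf (principal {\<beta>\<in>\<Gamma>. r a \<beta>}) (principal {\<beta>\<in>\<Gamma>. r b \<beta>})"
    if ab: "a \<in> \<Gamma>" "b \<in> \<Gamma>" for a b
  proof -
    obtain c where c: "c \<in> \<Gamma>" "r a c" "r b c"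
      using assms ab unfolding directed_set_def by blast
    have "r a \<beta> \<and> r b \<beta>" if "\<beta> \<in> \<Gamma>" "r c \<beta>" for \<beta>
      using assms ab c that unfolding directed_set_def by (meson transp_onD)
    then show ?thesis using c(1) by (intro bexI[of _ c]) auto
  qed
  then have "eventually P (net_filter \<Gamma> r) \<longleftrightarrow>
      (\<exists>\<alpha>\<in>\<Gamma>. eventually P (principal {\<beta>\<in>\<Gamma>. r \<alpha> \<beta>}))"
    unfolding net_filter_def using assms
    by (intro eventually_INF_base) (auto simp: directed_set_def)
  then show ?thesis by (auto simp: eventually_principal)
qed

lemma order_convI:
  fixes \<Lambda> :: "'j set" and a :: "'j \<Rightarrow> 'z::vector_lattice"
  assumes dir: "directed_set \<Lambda> s" and dec: "decreases_to_zero \<Lambda> s a"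
    and dom: "\<And>\<gamma>. \<gamma> \<in> \<Lambda> \<Longrightarrow> \<exists>\<alpha>\<^sub>0\<in>\<Gamma>. \<forall>\<alpha>\<in>\<Gamma>. r \<alpha>\<^sub>0 \<alpha> \<longrightarrow> \<bar>x \<alpha> - l\<bar> \<le> a \<gamma>"
  shows "order_conv \<Gamma> r x l"
  unfolding order_conv_def
proof (intro exI conjI)
  show "directed_set (a ` \<Lambda>) (\<ge>)"
  proof -
    have "\<exists>w\<in>a ` \<Lambda>. u \<ge> w \<and> v \<ge> w" if "u \<in> a ` \<Lambda>" "v \<in> a ` \<Lambda>" for u v
    proof -
      from that obtain \<gamma> \<delta> where gd: "\<gamma> \<in> \<Lambda>" "\<delta> \<in> \<Lambda>" "u = a \<gamma>" "v = a \<delta>"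
        by blast
      obtain \<eta> where "\<eta> \<in> \<Lambda>" "s \<gamma> \<eta>" "s \<delta> \<eta>"
        using dir gd unfolding directed_set_def by blast
      moreover have "monotone_on \<Lambda> s (\<ge>) a"
        using dec by (simp add: decreases_to_zero_def)
      ultimately show ?thesis
        using gd by (metis monotone_onD imageI)
    qed
    moreover have "a ` \<Lambda> \<noteq> {}" using dir by (simp add: directed_set_def)
    moreover have "reflp_on (a ` \<Lambda>) (\<ge>)" "transp_on (a ` \<Lambda>) (\<ge>)"
      by (auto intro!: reflp_onI transp_onI intro: order_trans)
    ultimately show ?thesis unfolding directed_set_def by blast
  qed
  show "decreases_to_zero (a ` \<Lambda>) (\<ge>) id"
    using dec by (auto simp: decreases_to_zero_def monotone_on_def)
  show "\<forall>\<gamma>\<in>a ` \<Lambda>. \<exists>\<alpha>\<^sub>0\<in>\<Gamma>. \<forall>\<alpha>\<in>\<Gamma>. r \<alpha>\<^sub>0 \<alpha> \<longrightarrow> \<bar>x \<alpha> - l\<bar> \<le> id \<gamma>"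
    using dom by auto
qed

lemma order_conv_Inl:
  fixes \<Gamma> :: "'i set" and x :: "'i \<Rightarrow> 'z::vector_lattice"
  shows "order_conv (Inl ` \<Gamma> :: ('i + 'k) set) (\<lambda>\<alpha> \<beta>. r (projl \<alpha>) (projl \<beta>))
           (\<lambda>\<alpha>. x (projl \<alpha>)) l \<longleftrightarrow> order_conv \<Gamma> r x l"
  by (simp add: order_conv_def)

end

(*
  The norm is additive on the positive cone of the completion Z (density), so a downward
  directed set of positive elements with infimum 0 contains elements of arbitrarily small norm;
  hence order continuity of x0 on X amounts to: infima of directed sets in X survive in Z, which
  is regularity. If X is order dense, every z >= 0 is the supremum of the elements of X in [0, z],
  and so every z below some u in X is the infimum of the elements of X in [z, u]; this transfers
  dominating nets from Z back to X. In the other direction, uo-convergence passes from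
  X to Z because the part of z >= 0 outside a large x in X is small in norm.
*)
theory Submission
  imports Defs
begin

section \<open>Vector lattices\<close>

lemma isGlb_UNIV_iff:
  "isGlb UNIV A y \<longleftrightarrow> (\<forall>a\<in>A. y \<le> a) \<and> (\<forall>w. (\<forall>a\<in>A. w \<le> a) \<longrightarrow> w \<le> y)"
  by (auto simp: isGlb_def isLb_def greatestP_def setge_def setle_def)

lemma isGlb_UNIV_I:
  assumes "\<And>a. a \<in> A \<Longrightarrow> y \<le> a" "\<And>w. (\<And>a. a \<in> A \<Longrightarrow> w \<le> a) \<Longrightarrow> w \<le> y"
  shows "isGlb UNIV A y"
  using assms by (simp add: isGlb_UNIV_iff)

lemma isGlb_UNIV_greatest:
  assumes "isGlb UNIV A y" "\<And>a. a \<in> A \<Longrightarrow> w \<le> a"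
  shows "w \<le> y"
  using assms by (simp add: isGlb_UNIV_iff)

lemma isLub_UNIV_iff:
  "isLub UNIV A y \<longleftrightarrow> (\<forall>a\<in>A. a \<le> y) \<and> (\<forall>w. (\<forall>a\<in>A. a \<le> w) \<longrightarrow> y \<le> w)"
  by (auto simp: isLub_def isUb_def leastP_def setge_def setle_def)

lemma isLub_UNIV_least:
  assumes "isLub UNIV A y" "\<And>a. a \<in> A \<Longrightarrow> a \<le> w"
  shows "y \<le> w"
  using assms by (simp add: isLub_UNIV_iff)

lemma directed_set_ge_iff:
  fixes B :: "'a::preorder set"
  shows "directed_set B (\<ge>) \<longleftrightarrow> B \<noteq> {} \<and> (\<forall>a\<in>B. \<forall>b\<in>B. \<exists>c\<in>B. c \<le> a \<and> c \<le> b)"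
proof -
  have "reflp_on B (\<ge>)" "transp_on B (\<ge>)"
    by (auto intro!: reflp_onI transp_onI intro: order_trans)
  then show ?thesis by (auto simp: directed_set_def)
qed

text \<open>Since \<open>z - inf a b = sup (z - a) (z - b)\<close>, the errors of two approximations
  of \<open>z\<close> at worst add up under \<open>inf\<close>. This keeps finite infima of good
  approximants close to \<open>z\<close>.\<close>

lemma abs_diff_inf_le:
  fixes a b z :: "'a::vector_lattice"
  shows "\<bar>z - inf a b\<bar> \<le> \<bar>z - a\<bar> + \<bar>z - b\<bar>"
proof (rule abs_leI)
  have "z - inf a b = sup (z - a) (z - b)"
    by (simp add: diff_inf_eq_sup add_sup_distrib_left)
  also have "\<dots> \<le> \<bar>z - a\<bar> + \<bar>z - b\<bar>"
    by (intro le_supI) (metis abs_ge_self abs_ge_zero add_increasing add_increasing2)+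
  finally show "z - inf a b \<le> \<bar>z - a\<bar> + \<bar>z - b\<bar>" .
next
  have "- (z - inf a b) \<le> a - z" by simp
  also have "\<dots> \<le> \<bar>z - a\<bar>" by (metis abs_ge_minus_self minus_diff_eq)
  also have "\<dots> \<le> \<bar>z - a\<bar> + \<bar>z - b\<bar>" by simp
  finally show "- (z - inf a b) \<le> \<bar>z - a\<bar> + \<bar>z - b\<bar>" .
qed

text \<open>Changing the truncation level from \<open>z\<close> to \<open>x\<close> costs at most
  the positive part of \<open>z - x\<close>, because \<open>z\<close> minus that part is at most
  \<open>x\<close>. Later \<open>x\<close> comes from \<open>X\<close> and lies close to
  \<open>z\<close> in norm.\<close>

lemma inf_le_inf_add_pos_part:
  fixes u x z :: "'a::vector_lattice"
  shows "inf u z \<le> inf u x + sup (z - x) 0"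
proof -
  define p where "p = sup (z - x) 0"
  have "0 \<le> p" "z - x \<le> p" by (simp_all add: p_def)
  have "inf u z - p \<le> u - 0"
    using \<open>0 \<le> p\<close> by (intro diff_mono) auto
  moreover have "inf u z - p \<le> z - (z - x)"
    using \<open>z - x \<le> p\<close> by (intro diff_mono) auto
  ultimately have "inf u z - p \<le> inf u x" by simp
  then show ?thesis unfolding p_def[symmetric] by (simp only: diff_le_eq)
qed

section \<open>Order and uo-convergence to zero expressed by eventual upper bounds\<close>

text \<open>The eventual upper bounds of the moduli contain the values of every dominating net. They
  are closed under \<open>inf\<close>, so, ordered downwards, they form a dominating net themselves
  as soon as their infimum is 0.\<close>

lemma order_conv_zero_iff:
  fixes x :: "'i \<Rightarrow> 'z::vector_lattice"
  assumes dir: "directed_set \<Gamma> r"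
  shows "order_conv \<Gamma> r x 0 \<longleftrightarrow>
    isGlb UNIV {w. \<forall>\<^sub>F \<alpha> in net_filter \<Gamma> r. \<bar>x \<alpha>\<bar> \<le> w} 0" (is "_ \<longleftrightarrow> isGlb UNIV ?D 0")
proof
  have nonneg: "0 \<le> w" if "w \<in> ?D" for w
  proof -
    from that obtain \<alpha> where "\<alpha> \<in> \<Gamma>" "\<forall>\<beta>\<in>\<Gamma>. r \<alpha> \<beta> \<longrightarrow> \<bar>x \<beta>\<bar> \<le> w"
      by (auto simp: eventually_net_filter[OF dir])
    moreover have "r \<alpha> \<alpha>"
      using dir \<open>\<alpha> \<in> \<Gamma>\<close> by (auto simp: directed_set_def reflp_on_def)
    ultimately have "\<bar>x \<alpha>\<bar> \<le> w" by blast
    then show ?thesis by (meson abs_ge_zero order_trans)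
  qed
  show "isGlb UNIV ?D 0" if "order_conv \<Gamma> r x 0"
  proof -
    from that obtain \<Lambda> :: "'z set" and s and a :: "'z \<Rightarrow> 'z" where
      glb: "isGlb UNIV (a ` \<Lambda>) 0" and
      dom: "\<forall>\<gamma>\<in>\<Lambda>. \<exists>\<alpha>\<^sub>0\<in>\<Gamma>. \<forall>\<alpha>\<in>\<Gamma>. r \<alpha>\<^sub>0 \<alpha> \<longrightarrow> \<bar>x \<alpha> - 0\<bar> \<le> a \<gamma>"
      unfolding order_conv_def decreases_to_zero_def by blast
    have "a ` \<Lambda> \<subseteq> ?D"
      using dom by (auto simp: eventually_net_filter[OF dir])
    then show ?thesis using glb nonneg unfolding isGlb_UNIV_iff by blast
  qed
  show "order_conv \<Gamma> r x 0" if glb: "isGlb UNIV ?D 0"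
  proof (rule order_convI)
    \<comment> \<open>If \<open>?D\<close> were empty, its infimum 0 would be a greatest element.
      Then 0 itself would bound every modulus and belong to \<open>?D\<close>.\<close>
    have "?D \<noteq> {}"
    proof
      assume empty: "?D = {}"
      then have le0: "w \<le> 0" for w :: 'z using glb by (auto simp: isGlb_UNIV_iff)
      have "0 \<in> ?D" using le0 by (simp add: always_eventually)
      then show False using empty by blast
    qed
    moreover have "inf v w \<in> ?D" if "v \<in> ?D" "w \<in> ?D" for v w
      using that by (auto elim: eventually_elim2)
    ultimately show "directed_set ?D (\<ge>)"
      unfolding directed_set_ge_iff by (meson inf.cobounded1 inf.cobounded2)
    show "decreases_to_zero ?D (\<ge>) id"
      using glb by (simp add: decreases_to_zero_def monotone_on_def)
  qed (simp add: eventually_net_filter[OF dir])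
qed

lemma uo_conv_zero_iff:
  fixes x :: "'i \<Rightarrow> 'z::vector_lattice"
  assumes "directed_set \<Gamma> r"
  shows "uo_conv \<Gamma> r x 0 \<longleftrightarrow>
    (\<forall>z\<ge>0. isGlb UNIV {w. \<forall>\<^sub>F \<alpha> in net_filter \<Gamma> r. inf \<bar>x \<alpha>\<bar> z \<le> w} 0)"
proof -
  have "\<bar>inf \<bar>x \<alpha>\<bar> z\<bar> = inf \<bar>x \<alpha>\<bar> z" if "0 \<le> z" for \<alpha> z
    using that by (intro abs_of_nonneg) simp
  then show ?thesis unfolding uo_conv_def by (simp add: order_conv_zero_iff[OF assms])
qed

text \<open>A directed set is a decreasing net indexed by itself and is its own dominating net. The
  copy under \<open>Inr\<close> fits the index type on which order continuity is tested.\<close>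

lemma order_conv_directed_set:
  fixes B :: "'x::vector_lattice set"
  assumes dir: "directed_set B (\<ge>)" and glb: "isGlb UNIV B 0"
  shows "order_conv (Inr ` B :: ('i + 'x) set) (\<lambda>\<alpha> \<beta>. projr \<alpha> \<ge> projr \<beta>) projr 0"
proof (rule order_convI[OF dir])
  show "decreases_to_zero B (\<ge>) id"
    using glb by (simp add: decreases_to_zero_def monotone_on_def)
  have "\<bar>b\<bar> = b" if "b \<in> B" for b
    using that glb by (auto simp: isGlb_UNIV_iff intro: abs_of_nonneg)
  then show "\<exists>\<alpha>\<^sub>0\<in>Inr ` B. \<forall>\<alpha>\<in>Inr ` B. projr \<alpha>\<^sub>0 \<ge> projr \<alpha> \<longrightarrow> \<bar>projr \<alpha> - 0\<bar> \<le> id b"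
    if "b \<in> B" for b
    using that by auto
qed

lemma directed_set_Inr:
  assumes "directed_set B (\<ge>)"
  shows "directed_set (Inr ` B :: ('i + 'x::vector_lattice) set) (\<lambda>\<alpha> \<beta>. projr \<alpha> \<ge> projr \<beta>)"
proof -
  have "\<exists>\<gamma>\<in>Inr ` B. projr \<gamma> \<le> projr \<alpha> \<and> projr \<gamma> \<le> projr \<beta>"
    if "\<alpha> \<in> Inr ` B" "\<beta> \<in> Inr ` B" for \<alpha> \<beta> :: "'i + 'x"
    using assms that by (force simp: directed_set_ge_iff)
  moreover have "Inr ` B \<noteq> {}" using assms by (simp add: directed_set_ge_iff)
  ultimately show ?thesis
    unfolding directed_set_def
    by (auto intro!: reflp_onI transp_onI intro: order_trans)
qed

text \<open>Closing a set under finite infima makes it downward directed without changing its lower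
  bounds, so results on directed sets become available for arbitrary nonempty sets.\<close>

definition finite_infs :: "'a::lattice set \<Rightarrow> 'a set" where
  "finite_infs A = {Inf_fin F | F. finite F \<and> F \<noteq> {} \<and> F \<subseteq> A}"

lemma subset_finite_infs: "A \<subseteq> finite_infs A"
proof
  fix a assume "a \<in> A"
  moreover have "a = Inf_fin {a}" by simp
  ultimately show "a \<in> finite_infs A" unfolding finite_infs_def by blast
qed

lemma directed_set_finite_infs:
  assumes "A \<noteq> {}"
  shows "directed_set (finite_infs A) (\<ge>)"
proof -
  have "\<exists>c\<in>finite_infs A. c \<le> a \<and> c \<le> b"
    if ab: "a \<in> finite_infs A" "b \<in> finite_infs A" for a b
  proof -
    obtain F G where F: "a = Inf_fin F" "finite F" "F \<noteq> {}" "F \<subseteq> A"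
      and G: "b = Inf_fin G" "finite G" "G \<noteq> {}" "G \<subseteq> A"
      using ab unfolding finite_infs_def by blast
    then have "Inf_fin (F \<union> G) = inf a b" by (simp add: Inf_fin.union)
    moreover have "Inf_fin (F \<union> G) \<in> finite_infs A"
      using F G unfolding finite_infs_def by blast
    ultimately show ?thesis by (metis inf.cobounded1 inf.cobounded2)
  qed
  then show ?thesis
    using assms subset_finite_infs[of A] by (auto simp: directed_set_ge_iff)
qed

lemma lower_bound_finite_infs_iff:
  "(\<forall>b\<in>finite_infs A. w \<le> b) \<longleftrightarrow> (\<forall>a\<in>A. w \<le> a)"
proof
  show "\<forall>a\<in>A. w \<le> a" if "\<forall>b\<in>finite_infs A. w \<le> b"
    using that subset_finite_infs[of A] by blast
  show "\<forall>b\<in>finite_infs A. w \<le> b" if "\<forall>a\<in>A. w \<le> a"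
    using that by (auto simp: finite_infs_def intro!: Inf_fin.boundedI)
qed

lemma isGlb_finite_infs_iff: "isGlb UNIV (finite_infs A) y \<longleftrightarrow> isGlb UNIV A y"
  by (simp add: isGlb_UNIV_iff lower_bound_finite_infs_iff)

section \<open>Approximation of elements from an order dense sublattice\<close>

text \<open>Archimedes: if \<open>w\<close> dominates \<open>Y \<inter> [0, z]\<close> but not \<open>z\<close>, then \<open>z - inf w z\<close> dominates
  some \<open>0 < y \<in> Y\<close>, and all multiples of \<open>y\<close> stay below \<open>z\<close>.\<close>

lemma order_dense_sublattice_isLub:
  fixes z :: "'z::banach_lattice"
  assumes Y: "order_dense_sublattice Y" and z: "0 \<le> z"
  shows "isLub UNIV {y \<in> Y. 0 \<le> y \<and> y \<le> z} z"
proof -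
  have sub: "subspace Y" and dense: "\<And>z. z > 0 \<Longrightarrow> \<exists>y\<in>Y. 0 < y \<and> y \<le> z"
    using Y by (auto simp: order_dense_sublattice_def vector_sublattice_def)
  have "z \<le> w" if ub: "\<And>y. y \<in> Y \<Longrightarrow> 0 \<le> y \<Longrightarrow> y \<le> z \<Longrightarrow> y \<le> w" for w
  proof (rule ccontr)
    assume "\<not> z \<le> w"
    then have "z - inf w z > 0"
      by (metis diff_gt_0_iff_gt inf.absorb_iff2 inf.cobounded2 order_le_less)
    then obtain y where y: "y \<in> Y" "0 < y" "y \<le> z - inf w z" using dense by blast
    have "real n *\<^sub>R y \<le> z" for n
    proof (induction n)
      case (Suc n)
      have "real n *\<^sub>R y \<in> Y" using sub y(1) by (simp add: subspace_scale)
      then have "real n *\<^sub>R y \<le> inf w z"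
        using Suc y(2) ub by (simp add: scaleR_nonneg_nonneg)
      then have "real n *\<^sub>R y + y \<le> inf w z + (z - inf w z)"
        using y(3) by (rule add_mono)
      also have "\<dots> = z" by (subst add.commute) (rule diff_add_cancel)
      finally show ?case by (simp add: scaleR_add_left add.commute)
    qed (use z in simp)
    then have "y \<le> 0" by (rule banach_lattice_archimedean)
    then show False using y(2) by simp
  qed
  then show ?thesis by (auto simp: isLub_UNIV_iff)
qed

text \<open>The reflection at \<open>u\<close>, sending \<open>y\<close> to \<open>u - y\<close>,
  preserves \<open>Y\<close> and turns the supremum over \<open>[0, u - z]\<close> into the infimum
  over \<open>[z, u]\<close>.\<close>

lemma order_dense_sublattice_isGlb:
  fixes z u :: "'z::banach_lattice"
  assumes Y: "order_dense_sublattice Y" and u: "u \<in> Y" and zu: "z \<le> u"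
  shows "isGlb UNIV {y \<in> Y. z \<le> y \<and> y \<le> u} z"
proof -
  have sub: "subspace Y"
    using Y by (auto simp: order_dense_sublattice_def vector_sublattice_def)
  have "w \<le> z" if lb: "\<And>y. y \<in> Y \<Longrightarrow> z \<le> y \<Longrightarrow> y \<le> u \<Longrightarrow> w \<le> y" for w
  proof -
    have "y \<le> u - w" if "y \<in> Y" "0 \<le> y" "y \<le> u - z" for y
    proof -
      have "w \<le> u - y"
        using that u sub by (intro lb) (auto simp: subspace_diff algebra_simps)
      then show ?thesis by (simp add: algebra_simps)
    qed
    then have "u - z \<le> u - w"
      using order_dense_sublattice_isLub[OF Y, of "u - z"] zu by (auto simp: isLub_UNIV_iff)
    then show ?thesis by simp
  qed
  then show ?thesis by (auto simp: isGlb_UNIV_iff)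
qed


section \<open>Banach lattices\<close>

lemma norm_mono_nonneg:
  fixes x y :: "'z::banach_lattice"
  assumes "0 \<le> x" "x \<le> y"
  shows "norm x \<le> norm y"
  using assms by (intro norm_mono_abs) (simp add: abs_of_nonneg order_trans[OF assms])

lemma norm_abs_vl: "norm \<bar>x\<bar> = norm (x::'z::banach_lattice)"
  by (intro antisym norm_mono_abs) simp_all

text \<open>The negative part of \<open>z\<close> is dominated by every
  \<open>\<bar>u n - z\<bar>\<close>, so its norm is 0.\<close>

lemma nonneg_limit:
  fixes u :: "nat \<Rightarrow> 'z::banach_lattice"
  assumes lim: "u \<longlonglongrightarrow> z" and nonneg: "\<And>n. 0 \<le> u n"
  shows "0 \<le> z"
proof -
  have "norm (sup (- z) 0) \<le> norm (u n - z)" for n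
  proof (rule norm_mono_abs)
    have "- z \<le> u n - z" using nonneg by simp
    also have "\<dots> \<le> \<bar>u n - z\<bar>" by (rule abs_ge_self)
    finally show "\<bar>sup (- z) 0\<bar> \<le> \<bar>u n - z\<bar>" by (simp add: abs_of_nonneg)
  qed
  moreover have "(\<lambda>n. norm (u n - z)) \<longlonglongrightarrow> 0"
    using lim by (simp add: LIM_zero tendsto_norm_zero)
  ultimately have "norm (sup (- z) 0) \<le> 0"
    by (intro LIMSEQ_le_const) auto
  then have "sup (- z) 0 = 0" by simp
  then show ?thesis by (metis neg_le_0_iff_le sup.cobounded1)
qed

lemma le_limit:
  fixes u v :: "nat \<Rightarrow> 'z::banach_lattice"
  assumes "u \<longlonglongrightarrow> a" "v \<longlonglongrightarrow> b" "\<And>n. u n \<le> v n"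
  shows "a \<le> b"
  using nonneg_limit[OF tendsto_diff[OF assms(2,1)]] assms(3) by simp

lemma tendsto_abs_vl:
  fixes u :: "nat \<Rightarrow> 'z::banach_lattice"
  assumes "u \<longlonglongrightarrow> a"
  shows "(\<lambda>n. \<bar>u n\<bar>) \<longlonglongrightarrow> \<bar>a\<bar>"
proof (rule Lim_transform_bound[THEN LIM_zero_cancel])
  show "(\<lambda>n. u n - a) \<longlonglongrightarrow> 0" using assms by (rule LIM_zero)
  have "norm (\<bar>u n\<bar> - \<bar>a\<bar>) \<le> norm (u n - a)" for n
    by (intro norm_mono_abs abs_triangle_ineq3)
  then show "\<forall>\<^sub>F n in sequentially. norm (\<bar>u n\<bar> - \<bar>a\<bar>) \<le> norm (u n - a)" by simp
qed

text \<open>In a downward directed set, additivity turns near-minimality of the norms into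
  norm closeness, so a norm-minimising sequence is Cauchy and its limit is a lower bound.\<close>

lemma additive_norm_directed_isGlb_zero:
  fixes B :: "'z::banach_lattice set"
  assumes add: "\<And>a b::'z. 0 \<le> a \<Longrightarrow> 0 \<le> b \<Longrightarrow> norm (a + b) = norm a + norm b"
    and dir: "directed_set B (\<ge>)" and glb: "isGlb UNIV B 0" and "0 < e"
  shows "\<exists>b\<in>B. norm b < e"
proof -
  have ne: "B \<noteq> {}" and down: "\<And>a b. a \<in> B \<Longrightarrow> b \<in> B \<Longrightarrow> \<exists>c\<in>B. c \<le> a \<and> c \<le> b"
    using dir by (auto simp: directed_set_ge_iff)
  have nonneg: "0 \<le> b" if "b \<in> B" for b
    using glb that by (auto simp: isGlb_UNIV_iff)
  define L where "L = Inf (norm ` B)"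
  have L_le: "L \<le> norm b" if "b \<in> B" for b
    unfolding L_def using that by (intro cInf_lower bdd_belowI[of _ 0]) auto
  have "\<exists>b\<in>B. norm b < L + inverse (real (Suc n))" for n
  proof -
    have "Inf (norm ` B) < L + inverse (real (Suc n))" by (simp add: L_def)
    from cInf_lessD[OF _ this] ne show ?thesis by auto
  qed
  then obtain b where b: "\<And>n. b n \<in> B" "\<And>n. norm (b n) < L + inverse (real (Suc n))"
    by metis
  have close: "norm (b n - c) < inverse (real (Suc n))" if "c \<in> B" "c \<le> b n" for c n
    using add[of c "b n - c"] L_le[of c] b(2)[of n] nonneg that by simp
  have "Cauchy b"
  proof (rule CauchyI)
    fix e :: real assume "0 < e"
    then obtain N where N: "inverse (real (Suc N)) < e / 2"
      using reals_Archimedean[of "e / 2"] by auto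
    have "norm (b m - b n) < e" if mn: "m \<ge> N" "n \<ge> N" for m n
    proof -
      obtain c where c: "c \<in> B" "c \<le> b m" "c \<le> b n" using down b(1) by meson
      have *: "norm (b k - c) < e / 2" if "k \<ge> N" "c \<le> b k" for k
      proof -
        have "inverse (real (Suc k)) \<le> inverse (real (Suc N))" using that by simp
        then show ?thesis using close[of c k] c(1) that N by linarith
      qed
      have "norm (b m - b n) \<le> norm (b m - c) + norm (b n - c)"
        by (rule norm_triangle_le_diff[of "b m - c" "b n - c", simplified, OF order_refl])
      then show ?thesis using *[of m] *[of n] c mn by linarith
    qed
    then show "\<exists>N. \<forall>m\<ge>N. \<forall>n\<ge>N. norm (b m - b n) < e" by blast
  qed
  then obtain l where l: "b \<longlonglongrightarrow> l" by (metis Cauchy_convergent_iff convergent_def)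
  have "l \<le> a" if a: "a \<in> B" for a
  proof -
    \<comment> \<open>The elements \<open>c n\<close> lie below \<open>a\<close> and, by
      \<open>close\<close>, have the same limit \<open>l\<close> as \<open>b\<close>; this forces
      \<open>l \<le> a\<close>.\<close>
    have "\<exists>c\<in>B. c \<le> a \<and> c \<le> b n" for n using down a b(1) by blast
    then obtain c where c: "\<And>n. c n \<in> B" "\<And>n. c n \<le> a" "\<And>n. c n \<le> b n" by metis
    have "(\<lambda>n. b n - c n) \<longlonglongrightarrow> 0"
    proof (rule Lim_null_comparison)
      show "\<forall>\<^sub>F n in sequentially. norm (b n - c n) \<le> inverse (real (Suc n))"
        using close c by (simp add: less_imp_le)
    qed (rule LIMSEQ_inverse_real_of_nat)
    from tendsto_diff[OF l this] have "c \<longlonglongrightarrow> l" by simp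
    then show ?thesis using c(2) by (rule le_limit[OF _ tendsto_const])
  qed
  then have "l \<le> 0" using glb by (auto simp: isGlb_UNIV_iff)
  moreover have "0 \<le> l" by (rule nonneg_limit[OF l]) (rule nonneg[OF b(1)])
  ultimately have "l = 0" by simp
  then have "\<forall>\<^sub>F n in sequentially. norm (b n) < e"
    using l \<open>0 < e\<close> by (auto simp: tendsto_iff)
  then show ?thesis using b(1) by (auto simp: eventually_sequentially)
qed


section \<open>The completion of \<open>X\<close> in the norm of a strictly positive functional\<close>

locale L_completion =
  fixes f :: "'x::vector_lattice \<Rightarrow> real" and J :: "'x \<Rightarrow> 'z::banach_lattice"
  assumes linear_f: "linear f"
    and strictly_positive_f: "strictly_positive f"
    and completion: "norm_completion (L_norm f) J"
begin

section \<open>The embedding, its dense range and additivity of the norm\<close>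

lemma f_nonneg: "0 \<le> x \<Longrightarrow> 0 \<le> f x"
  using strictly_positive_f linear_0[OF linear_f]
  by (metis strictly_positive_def order_le_less)

lemma f_mono: "x \<le> y \<Longrightarrow> f x \<le> f y"
  using f_nonneg[of "y - x"] by (simp add: linear_diff[OF linear_f])

lemma norm_J: "norm (J x) = f \<bar>x\<bar>"
  using completion by (simp add: norm_completion_def L_norm_def)

lemma linear_J: "linear J"
  and J_sup: "J (sup x y) = sup (J x) (J y)"
  and J_inf: "J (inf x y) = inf (J x) (J y)"
  using completion by (simp_all add: norm_completion_def lattice_homomorphism_def)

lemmas J_simps = linear_0[OF linear_J] linear_add[OF linear_J] linear_diff[OF linear_J]
  linear_neg[OF linear_J]

lemma J_abs: "J \<bar>x\<bar> = \<bar>J x\<bar>"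
  by (simp add: abs_lattice J_sup J_simps)

text \<open>Strict positivity makes \<open>f \<bar>x\<bar>\<close> a norm and not merely a
  seminorm.\<close>

lemma J_eq_0_iff: "J x = 0 \<longleftrightarrow> x = 0"
proof
  assume "J x = 0"
  then have "f \<bar>x\<bar> = 0" by (metis norm_J norm_zero)
  then show "x = 0"
    using strictly_positive_f by (metis less_irrefl strictly_positive_def zero_less_abs_iff)
qed (simp add: J_simps)

lemma J_eq_iff: "J x = J y \<longleftrightarrow> x = y"
  using J_eq_0_iff[of "x - y"] by (simp add: J_simps)

lemma J_le_iff: "J x \<le> J y \<longleftrightarrow> x \<le> y"
  by (metis J_eq_iff J_inf inf.absorb_iff1)

lemma J_nonneg_iff: "0 \<le> J x \<longleftrightarrow> 0 \<le> x"
  using J_le_iff[of 0 x] by (simp add: J_simps)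

lemma vector_sublattice_range_J: "vector_sublattice (range J)"
proof -
  have "subspace (range J)"
    by (intro linear_subspace_image linear_J subspace_UNIV)
  then show ?thesis
    by (auto simp: vector_sublattice_def simp flip: J_sup J_inf)
qed

lemma isGlb_range_J_iff: "isGlb (range J) (J ` A) (J y) \<longleftrightarrow> isGlb UNIV A y"
proof -
  have "isGlb (range J) (J ` A) (J y) \<longleftrightarrow>
      (\<forall>a\<in>A. J y \<le> J a) \<and> (\<forall>w. (\<forall>a\<in>A. J w \<le> J a) \<longrightarrow> J w \<le> J y)"
    unfolding isGlb_def isLb_def greatestP_def setge_def setle_def by blast
  then show ?thesis by (simp add: isGlb_UNIV_iff J_le_iff)
qed

lemma J_dense: obtains u where "(\<lambda>n. J (u n)) \<longlonglongrightarrow> z"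
proof -
  have "z \<in> closure (range J)" using completion by (simp add: norm_completion_def)
  then obtain v where v: "\<And>n. v n \<in> range J" "v \<longlonglongrightarrow> z"
    by (auto simp: closure_sequential)
  have "\<forall>n. \<exists>x. v n = J x" using v(1) by blast
  then obtain u where "\<forall>n. v n = J (u n)" by (rule choice[THEN exE])
  then have "v = (\<lambda>n. J (u n))" by blast
  then show ?thesis using v(2) that[of u] by simp
qed

text \<open>The modulus is norm continuous, so the moduli of an approximating sequence have the same
  limit \<open>z\<close>.\<close>

lemma J_dense_nonneg:
  assumes "0 \<le> z"
  obtains u where "\<And>n. 0 \<le> u n" "(\<lambda>n. J (u n)) \<longlonglongrightarrow> z"
proof -
  obtain u where "(\<lambda>n. J (u n)) \<longlonglongrightarrow> z" by (rule J_dense)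
  then have "(\<lambda>n. J \<bar>u n\<bar>) \<longlonglongrightarrow> z"
    using tendsto_abs_vl[of "\<lambda>n. J (u n)" z] assms by (simp add: J_abs abs_of_nonneg)
  then show ?thesis by (rule that[rotated]) simp
qed

lemma J_approx_nonneg:
  assumes "0 \<le> z" "0 < e"
  obtains x where "0 \<le> x" "norm (z - J x) < e"
proof -
  obtain u where u: "\<And>n. 0 \<le> u n" "(\<lambda>n. J (u n)) \<longlonglongrightarrow> z"
    using J_dense_nonneg[OF assms(1)] by blast
  then obtain n where "dist (J (u n)) z < e"
    using \<open>0 < e\<close> unfolding lim_sequentially by blast
  then show ?thesis
    using u(1) by (intro that[of "u n"]) (simp_all add: dist_norm norm_minus_commute)
qed

text \<open>On images of positive elements the norm is the linear \<open>f\<close>; additivity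
  extends to limits by continuity.\<close>

lemma norm_add_nonneg:
  fixes a b :: 'z
  assumes "0 \<le> a" "0 \<le> b"
  shows "norm (a + b) = norm a + norm b"
proof -
  obtain u where u: "\<And>n. 0 \<le> u n" "(\<lambda>n. J (u n)) \<longlonglongrightarrow> a"
    using J_dense_nonneg[OF assms(1)] by blast
  obtain v where v: "\<And>n. 0 \<le> v n" "(\<lambda>n. J (v n)) \<longlonglongrightarrow> b"
    using J_dense_nonneg[OF assms(2)] by blast
  have "norm (J (u n) + J (v n)) = norm (J (u n)) + norm (J (v n))" for n
    using u(1) v(1) by (simp add: norm_J abs_of_nonneg linear_add[OF linear_f] flip: linear_add[OF linear_J])
  then have "(\<lambda>n. norm (J (u n)) + norm (J (v n))) \<longlonglongrightarrow> norm (a + b)"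
    using tendsto_norm[OF tendsto_add[OF u(2) v(2)]] by simp
  moreover have "(\<lambda>n. norm (J (u n)) + norm (J (v n))) \<longlonglongrightarrow> norm a + norm b"
    by (intro tendsto_intros u v)
  ultimately show ?thesis by (rule LIMSEQ_unique)
qed

section \<open>Regularity and order continuity of the functional\<close>

lemma regular_imp_isGlb_zero:
  assumes "regular_sublattice (range J)" "isGlb UNIV A 0"
  shows "isGlb UNIV (J ` A) 0"
proof -
  have "isGlb UNIV (J ` A) (J 0)"
    using assms isGlb_range_J_iff[of A 0] unfolding regular_sublattice_def by blast
  then show ?thesis by (simp add: J_simps)
qed

text \<open>A translation moves the infimum to 0, and finite infima make the set directed. Neither
  changes the question, since \<open>J\<close> is linear and preserves finite infima.\<close>

lemma regular_sublatticeI: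
  assumes *: "\<And>B. directed_set B (\<ge>) \<Longrightarrow> isGlb UNIV B 0 \<Longrightarrow> isGlb UNIV (J ` B) 0"
  shows "regular_sublattice (range J)"
  unfolding regular_sublattice_def
proof (intro conjI allI impI vector_sublattice_range_J)
  fix A y
  assume sub: "A \<subseteq> range J" and glb: "isGlb (range J) A y"
  obtain C where C: "A = J ` C" using sub by (auto simp: subset_image_iff)
  obtain c where c: "y = J c" using isGlbD1a[OF glb] by blast
  have c_glb: "isGlb UNIV C c" using glb by (simp add: C c isGlb_range_J_iff)
  show "isGlb UNIV A y"
  proof (cases "C = {}")
    \<comment> \<open>An infimum of the empty set is a greatest element of \<open>X\<close>. This
      forces \<open>X\<close> to be zero and, by density, the completion too.\<close>
    case True
    then have "x \<le> c" for x using c_glb by (auto simp: isGlb_UNIV_iff)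
    from this[of "c + \<bar>x\<bar>" for x] have x0: "x = 0" for x :: 'x
      by (metis abs_le_zero_iff add_le_same_cancel1)
    have "z = 0" for z :: 'z
    proof -
      obtain u where "(\<lambda>n. J (u n)) \<longlonglongrightarrow> z" by (rule J_dense)
      moreover have "(\<lambda>n. J (u n)) = (\<lambda>n. 0)" using x0 J_eq_0_iff by blast
      ultimately show ?thesis by (simp add: LIMSEQ_const_iff)
    qed
    then show ?thesis using C True by (metis image_empty isGlb_UNIV_iff empty_iff order_refl)
  next
    case False
    define D where "D = (\<lambda>x. x - c) ` C"
    have "isGlb UNIV D 0"
      unfolding D_def isGlb_UNIV_iff
    proof (intro conjI allI impI ballI)
      fix w assume "\<forall>a\<in>(\<lambda>x. x - c) ` C. w \<le> a"
      then have "w + c \<le> c" using c_glb by (auto simp: isGlb_UNIV_iff le_diff_eq)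
      then show "w \<le> 0" by simp
    qed (use c_glb in \<open>auto simp: isGlb_UNIV_iff\<close>)
    then have "isGlb UNIV (J ` finite_infs D) 0"
      using False by (intro * directed_set_finite_infs) (auto simp: D_def isGlb_finite_infs_iff)
    then have D_glb: "w \<le> 0" if "\<And>b. b \<in> finite_infs D \<Longrightarrow> w \<le> J b" for w
      using that by (auto simp: isGlb_UNIV_iff)
    have "w \<le> J c" if w: "\<And>x. x \<in> C \<Longrightarrow> w \<le> J x" for w
    proof -
      have "w - J c \<le> J (Inf_fin F)" if "finite F" "F \<noteq> {}" "F \<subseteq> D" for F
        using that
      proof (induction F rule: finite_ne_induct)
        case (singleton d)
        then show ?case using w by (auto simp: D_def J_simps)
      next
        case (insert d F)
        then show ?case using w by (auto simp: D_def J_simps J_inf)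
      qed
      then have "w - J c \<le> 0" by (intro D_glb) (auto simp: finite_infs_def)
      then show ?thesis by simp
    qed
    then show ?thesis using c_glb by (auto simp: C c isGlb_UNIV_iff J_le_iff)
  qed
qed

text \<open>With \<open>B\<close> as a net over itself, the values of \<open>f\<close> tend to 0,
  and the element at which a small tail starts belongs to that tail.\<close>

lemma order_continuous_directed:
  assumes oc: "order_continuous TYPE('i + 'x) f"
    and dir: "directed_set B (\<ge>)" and glb: "isGlb UNIV B 0" and "0 < e"
  shows "\<exists>b\<in>B. f b < e"
proof -
  let ?\<Gamma> = "Inr ` B :: ('i + 'x) set" and ?r = "\<lambda>\<alpha> \<beta> :: 'i + 'x. projr \<alpha> \<ge> projr \<beta>"
  have dir': "directed_set ?\<Gamma> ?r" by (rule directed_set_Inr[OF dir])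
  then have "((\<lambda>\<alpha>. f (projr \<alpha>)) \<longlongrightarrow> 0) (net_filter ?\<Gamma> ?r)"
    using oc order_conv_directed_set[OF dir glb] unfolding order_continuous_def by blast
  then have "\<forall>\<^sub>F \<alpha> in net_filter ?\<Gamma> ?r. dist (f (projr \<alpha>)) 0 < e"
    using \<open>0 < e\<close> by (rule tendstoD)
  then obtain b where "b \<in> B" "\<forall>a\<in>B. a \<le> b \<longrightarrow> dist (f a) 0 < e"
    by (auto simp: eventually_net_filter[OF dir'])
  then show ?thesis by (auto simp: dist_real_def intro!: bexI[of _ b])
qed

text \<open>The positive part of a lower bound \<open>w\<close> is dominated by every
  \<open>J b\<close>, and the norms \<open>f b\<close> become arbitrarily small.\<close>

lemma order_continuous_imp_regular:
  assumes "order_continuous TYPE('i + 'x) f"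
  shows "regular_sublattice (range J)"
proof (rule regular_sublatticeI)
  fix B :: "'x set"
  assume dir: "directed_set B (\<ge>)" and glb: "isGlb UNIV B 0"
  have nonneg: "0 \<le> b" if "b \<in> B" for b
    using that glb by (auto simp: isGlb_UNIV_iff)
  have "w \<le> 0" if w: "\<And>b. b \<in> B \<Longrightarrow> w \<le> J b" for w
  proof -
    have "norm (sup w 0) < e" if "0 < e" for e
    proof -
      obtain b where b: "b \<in> B" "f b < e"
        using order_continuous_directed[OF assms dir glb \<open>0 < e\<close>] by blast
      have "norm (sup w 0) \<le> norm (J b)"
        using w nonneg b(1) by (intro norm_mono_nonneg) (auto simp: J_nonneg_iff)
      then show ?thesis using b nonneg by (simp add: norm_J abs_of_nonneg)
    qed
    then have "norm (sup w 0) \<le> 0" by (meson less_irrefl not_le)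
    then have "sup w 0 = 0" by simp
    then show ?thesis by (metis sup.cobounded1)
  qed
  then show "isGlb UNIV (J ` B) 0"
    using nonneg by (auto simp: isGlb_UNIV_iff J_nonneg_iff)
qed

text \<open>By regularity the dominating net keeps its infimum 0 in the completion. Additivity of
  the norm then yields a term with small \<open>f\<close>-value, which controls \<open>f\<close> on
  a tail.\<close>

lemma regular_imp_order_continuous:
  assumes reg: "regular_sublattice (range J)"
  shows "order_continuous TYPE('k) f"
  unfolding order_continuous_def
proof (intro allI impI)
  fix \<Gamma> :: "'k set" and r and x :: "'k \<Rightarrow> 'x"
  assume dir: "directed_set \<Gamma> r" and conv: "order_conv \<Gamma> r x 0"
  from conv obtain \<Lambda> :: "'x set" and s and a :: "'x \<Rightarrow> 'x" where
    \<Lambda>: "directed_set \<Lambda> s" and dec: "decreases_to_zero \<Lambda> s a" and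
    dom: "\<forall>\<gamma>\<in>\<Lambda>. \<exists>\<alpha>\<^sub>0\<in>\<Gamma>. \<forall>\<alpha>\<in>\<Gamma>. r \<alpha>\<^sub>0 \<alpha> \<longrightarrow> \<bar>x \<alpha> - 0\<bar> \<le> a \<gamma>"
    unfolding order_conv_def by blast
  let ?B = "J ` a ` \<Lambda>"
  have glb: "isGlb UNIV ?B 0"
    using regular_imp_isGlb_zero[OF reg] dec by (simp add: decreases_to_zero_def)
  have "\<exists>c\<in>?B. c \<le> u \<and> c \<le> v" if uv: "u \<in> ?B" "v \<in> ?B" for u v
  proof -
    from uv obtain \<gamma> \<delta> where \<gamma>\<delta>: "u = J (a \<gamma>)" "v = J (a \<delta>)" "\<gamma> \<in> \<Lambda>" "\<delta> \<in> \<Lambda>" by blast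
    then obtain \<eta> where \<eta>: "\<eta> \<in> \<Lambda>" "s \<gamma> \<eta>" "s \<delta> \<eta>"
      using \<Lambda> unfolding directed_set_def by blast
    then have "a \<eta> \<le> a \<gamma>" "a \<eta> \<le> a \<delta>"
      using dec \<gamma>\<delta> by (auto simp: decreases_to_zero_def monotone_on_def)
    then show ?thesis using \<gamma>\<delta> \<eta>(1) by (auto simp: J_le_iff)
  qed
  then have B: "directed_set ?B (\<ge>)"
    using \<Lambda> by (simp add: directed_set_ge_iff directed_set_def)
  have "\<forall>\<^sub>F \<alpha> in net_filter \<Gamma> r. dist (f (x \<alpha>)) 0 < e" if e: "0 < e" for e
  proof -
    obtain \<gamma> where \<gamma>: "\<gamma> \<in> \<Lambda>" "norm (J (a \<gamma>)) < e"
      using additive_norm_directed_isGlb_zero[OF norm_add_nonneg B glb e] by blast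
    have "0 \<le> a \<gamma>" using glb \<gamma>(1) by (auto simp: isGlb_UNIV_iff J_nonneg_iff)
    then have small: "f (a \<gamma>) < e" using \<gamma>(2) by (simp add: norm_J abs_of_nonneg)
    have bound: "dist (f y) 0 < e" if y: "\<bar>y\<bar> \<le> a \<gamma>" for y
    proof -
      have "y \<le> a \<gamma>" "- y \<le> a \<gamma>" using y by (auto simp: abs_le_iff)
      then have "f y \<le> f (a \<gamma>)" "- f y \<le> f (a \<gamma>)"
        using f_mono[of "- y" "a \<gamma>"] by (auto intro: f_mono simp: linear_neg[OF linear_f])
      then show ?thesis using small by (simp add: dist_real_def abs_less_iff)
    qed
    then show ?thesis
      using dom \<gamma>(1) unfolding eventually_net_filter[OF dir] by fastforce
  qed
  then show "((\<lambda>\<alpha>. f (x \<alpha>)) \<longlongrightarrow> 0) (net_filter \<Gamma> r)" by (rule tendstoI)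
qed

section \<open>Order density of the embedded lattice\<close>

text \<open>Approximate \<open>z\<close> by a sequence \<open>x\<^sub>n\<close> so fast that every finite infimum stays at distance
  less than \<open>norm z\<close> from \<open>z\<close>. The sequence then has a lower bound in \<open>X\<close> that is not \<open>\<le> 0\<close>,
  and every lower bound of it is below the limit \<open>z\<close>.\<close>

lemma order_continuous_imp_order_dense:
  assumes oc: "order_continuous TYPE('i + 'x) f"
  shows "order_dense_sublattice (range J)"
  unfolding order_dense_sublattice_def
proof (intro conjI allI impI vector_sublattice_range_J)
  fix z :: 'z assume "0 < z"
  \<comment> \<open>Half the norm leaves room for two errors: the approximations cost at most
    \<open>e\<close> in total, and an infimum of norm below \<open>e\<close> would then give
    \<open>norm z < 2 * e\<close>.\<close>
  define e where "e = norm z / 2"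
  have "0 < e" using \<open>0 < z\<close> by (auto simp: e_def)
  \<comment> \<open>Starting the powers at exponent 1 makes the bounds sum to exactly
    \<open>e\<close>.\<close>
  have "\<exists>x\<ge>0. norm (z - J x) < e * (1 / 2) ^ Suc n" for n
    using J_approx_nonneg[of z "e * (1 / 2) ^ Suc n"] \<open>0 < z\<close> \<open>0 < e\<close>
    by (metis order_less_imp_le half_gt_zero_iff mult_pos_pos zero_less_one zero_less_power)
  then obtain x where x: "\<And>n. 0 \<le> x n" "\<And>n. norm (z - J (x n)) < e * (1 / 2) ^ Suc n"
    by metis
  have inf_close: "norm (z - J (Inf_fin (x ` N))) \<le> (\<Sum>n\<in>N. e * (1 / 2) ^ Suc n)"
    if "finite N" "N \<noteq> {}" for N
    using that
  proof (induction N rule: finite_ne_induct)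
    case (singleton n)
    then show ?case using x(2)[of n] by simp
  next
    case (insert n N)
    have "norm (z - inf (J (x n)) (J (Inf_fin (x ` N))))
        \<le> norm (\<bar>z - J (x n)\<bar> + \<bar>z - J (Inf_fin (x ` N))\<bar>)"
      by (intro norm_mono_abs order_trans[OF abs_diff_inf_le abs_ge_self])
    also have "\<dots> \<le> norm (z - J (x n)) + norm (z - J (Inf_fin (x ` N)))"
      by (metis norm_abs_vl norm_triangle_ineq)
    also have "\<dots> \<le> e * (1 / 2) ^ Suc n + (\<Sum>n\<in>N. e * (1 / 2) ^ Suc n)"
      using x(2)[of n] insert.IH by linarith
    finally show ?case using insert.hyps by (simp add: J_inf)
  qed
  have geometric: "(\<lambda>n. e * (1 / 2) ^ Suc n) sums e"
    using sums_mult[OF power_half_series, of e] by simp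
  have "\<not> isGlb UNIV (range x) 0"
  proof
    assume "isGlb UNIV (range x) 0"
    then obtain b where b: "b \<in> finite_infs (range x)" "f b < e"
      using order_continuous_directed[OF oc directed_set_finite_infs, of "range x" e] \<open>0 < e\<close>
      by (auto simp: isGlb_finite_infs_iff)
    then obtain F where F: "finite F" "F \<noteq> {}" "F \<subseteq> range x" "b = Inf_fin F"
      unfolding finite_infs_def by blast
    \<comment> \<open>The errors are attached to indices, so the finite set of values is written as
      the image of a finite index set.\<close>
    then obtain N where "finite N" "F = x ` N"
      using finite_subset_image by metis
    with F have N: "finite N" "N \<noteq> {}" "b = Inf_fin (x ` N)" by auto
    have "0 \<le> b" using b(1) x(1) lower_bound_finite_infs_iff[of "range x" 0] by blast
    have "norm z \<le> norm (z - J b) + norm (J b)"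
      using norm_triangle_ineq[of "z - J b" "J b"] by simp
    also have "norm (z - J b) \<le> (\<Sum>n\<in>N. e * (1 / 2) ^ Suc n)"
      unfolding N(3) using N by (intro inf_close)
    also have "\<dots> \<le> (\<Sum>n. e * (1 / 2) ^ Suc n)"
      using geometric N(1) \<open>0 < e\<close> by (intro sum_le_suminf) (auto simp: sums_iff)
    also have "\<dots> = e" using geometric by (simp add: sums_iff)
    also have "norm (J b) < e" using b(2) \<open>0 \<le> b\<close> by (simp add: norm_J abs_of_nonneg)
    finally show False by (simp add: e_def)
  qed
  then obtain w where w: "\<And>n. w \<le> x n" "\<not> w \<le> 0"
    using x(1) by (auto simp: isGlb_UNIV_iff)
  define y where "y = sup w 0"
  have "0 \<le> y" "y \<noteq> 0" "\<And>n. y \<le> x n"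
    using w x(1) by (auto simp: y_def) (metis sup.cobounded1)
  then have "0 < J y" by (metis J_eq_0_iff J_nonneg_iff order_le_less)
  have "(\<lambda>n. z - J (x n)) \<longlonglongrightarrow> 0"
  proof (rule Lim_null_comparison)
    show "\<forall>\<^sub>F n in sequentially. norm (z - J (x n)) \<le> e * (1 / 2) ^ Suc n"
      using x(2) by (simp add: less_imp_le)
    show "(\<lambda>n. e * (1 / 2) ^ Suc n) \<longlonglongrightarrow> 0"
      using geometric by (intro summable_LIMSEQ_zero) (simp add: sums_iff)
  qed
  from tendsto_diff[OF tendsto_const[of z] this] have "(\<lambda>n. J (x n)) \<longlonglongrightarrow> z" by simp
  then have "J y \<le> z"
    by (rule le_limit[OF tendsto_const]) (simp add: J_le_iff \<open>\<And>n. y \<le> x n\<close>)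
  then show "\<exists>y\<in>range J. 0 < y \<and> y \<le> z" using \<open>0 < J y\<close>
    by (intro bexI[of _ "J y"]) simp_all
qed

text \<open>If a lower bound \<open>w\<close> in the completion had a nonzero positive part, order
  density would put some \<open>J x > 0\<close> below it, and \<open>x\<close> would be a positive
  lower bound of \<open>B\<close> in \<open>X\<close>.\<close>

lemma order_dense_imp_regular:
  assumes "order_dense_sublattice (range J)"
  shows "regular_sublattice (range J)"
proof (rule regular_sublatticeI)
  fix B :: "'x set"
  assume glb: "isGlb UNIV B 0"
  have "w \<le> 0" if w: "\<And>b. b \<in> B \<Longrightarrow> w \<le> J b" for w
  proof (rule ccontr)
    assume "\<not> w \<le> 0"
    then have "0 < sup w 0" by (metis order_le_less sup.cobounded1 sup.cobounded2)
    then obtain x where x: "0 < J x" "J x \<le> sup w 0"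
      using assms unfolding order_dense_sublattice_def by blast
    have "x \<le> b" if "b \<in> B" for b
    proof -
      have "0 \<le> J b" using glb that by (auto simp: isGlb_UNIV_iff J_nonneg_iff)
      then have "sup w 0 \<le> J b" using w that by simp
      then show ?thesis using x(2) by (metis J_le_iff order_trans)
    qed
    then have "x \<le> 0" using glb by (auto simp: isGlb_UNIV_iff)
    then show False using x(1) J_le_iff[of x 0] by (auto simp: J_simps)
  qed
  then show "isGlb UNIV (J ` B) 0"
    using glb by (auto simp: isGlb_UNIV_iff J_nonneg_iff)
qed

section \<open>Unbounded order convergence in \<open>X\<close> and in the completion\<close>

text \<open>For \<open>y \<ge> 0\<close> in \<open>X\<close>, eventual bounds of the net truncated
  at \<open>y\<close>, shifted by the positive part of \<open>z - J y\<close>, bound the net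
  truncated at \<open>z\<close>. By regularity a common lower bound \<open>v\<close> is at most this
  positive part, whose norm is arbitrarily small for suitable \<open>y\<close>.\<close>

lemma regular_imp_uo_conv:
  fixes x :: "'k \<Rightarrow> 'x"
  assumes reg: "regular_sublattice (range J)" and dir: "directed_set \<Gamma> r"
    and uo: "uo_conv \<Gamma> r x 0"
  shows "uo_conv \<Gamma> r (\<lambda>\<alpha>. J (x \<alpha>)) 0"
  unfolding uo_conv_zero_iff[OF dir]
proof (intro allI impI)
  fix z :: 'z assume "0 \<le> z"
  let ?D = "{w. \<forall>\<^sub>F \<alpha> in net_filter \<Gamma> r. inf \<bar>J (x \<alpha>)\<bar> z \<le> w}"
  have nontriv: "net_filter \<Gamma> r \<noteq> bot"
    using dir by (auto simp: trivial_limit_def eventually_net_filter directed_set_def reflp_on_def)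
  have nonneg: "0 \<le> w" if w: "w \<in> ?D" for w
  proof -
    obtain \<alpha> where "inf \<bar>J (x \<alpha>)\<bar> z \<le> w"
      using w eventually_happens'[OF nontriv] by fastforce
    moreover have "0 \<le> inf \<bar>J (x \<alpha>)\<bar> z" using \<open>0 \<le> z\<close> by simp
    ultimately show ?thesis by (rule order_trans[rotated])
  qed
  have greatest: "v \<le> 0" if v: "\<And>w. w \<in> ?D \<Longrightarrow> v \<le> w" for v
  proof -
    have le: "v \<le> sup (z - J y) 0" if "0 \<le> y" for y
    proof -
      let ?E = "{w. \<forall>\<^sub>F \<alpha> in net_filter \<Gamma> r. inf \<bar>x \<alpha>\<bar> y \<le> w}"
      have "isGlb UNIV (J ` ?E) 0"
        using uo \<open>0 \<le> y\<close> by (intro regular_imp_isGlb_zero[OF reg]) (simp add: uo_conv_zero_iff[OF dir])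
      moreover have "v - sup (z - J y) 0 \<le> u" if u: "u \<in> J ` ?E" for u
      proof -
        obtain w where w: "u = J w" "\<forall>\<^sub>F \<alpha> in net_filter \<Gamma> r. inf \<bar>x \<alpha>\<bar> y \<le> w"
          using u by blast
        have "\<forall>\<^sub>F \<alpha> in net_filter \<Gamma> r. inf \<bar>J (x \<alpha>)\<bar> z \<le> J w + sup (z - J y) 0"
          using w(2)
        proof (rule eventually_mono)
          fix \<alpha> assume "inf \<bar>x \<alpha>\<bar> y \<le> w"
          then have "inf \<bar>J (x \<alpha>)\<bar> (J y) \<le> J w" by (simp add: J_le_iff flip: J_abs J_inf)
          then show "inf \<bar>J (x \<alpha>)\<bar> z \<le> J w + sup (z - J y) 0"
            by (rule order_trans[OF inf_le_inf_add_pos_part add_right_mono])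
        qed
        then have "v \<le> J w + sup (z - J y) 0" by (intro v) simp
        then show ?thesis unfolding w(1) by (simp only: diff_le_eq)
      qed
      ultimately have "v - sup (z - J y) 0 \<le> 0" by (rule isGlb_UNIV_greatest)
      then show ?thesis by (simp only: diff_le_0_iff_le)
    qed
    have "norm (sup v 0) < e" if e: "0 < e" for e
    proof -
      obtain y where y: "0 \<le> y" "norm (z - J y) < e"
        using J_approx_nonneg[OF \<open>0 \<le> z\<close> e] by blast
      have "sup v 0 \<le> sup (z - J y) 0" using le[OF y(1)] by simp
      also have "\<dots> \<le> \<bar>z - J y\<bar>" by (simp add: abs_ge_self del: diff_le_0_iff_le)
      finally have "norm (sup v 0) \<le> norm (z - J y)"
        by (metis norm_abs_vl norm_mono_nonneg sup.cobounded2)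
      then show ?thesis using y(2) by simp
    qed
    then have "norm (sup v 0) \<le> 0" by (meson less_irrefl not_le)
    then have "sup v 0 = 0" by simp
    then show ?thesis by (metis sup.cobounded1)
  qed
  show "isGlb UNIV ?D 0" by (rule isGlb_UNIV_I[OF nonneg greatest])
qed

text \<open>An eventual bound \<open>w\<close>, cut at \<open>J z\<close>, lies below an element of
  \<open>range J\<close> and is therefore the infimum of the elements of \<open>range J\<close>
  between it and \<open>J z\<close>. These are again eventual bounds, so those coming from
  \<open>X\<close> already determine the infimum.\<close>

lemma order_dense_imp_uo_conv:
  fixes x :: "'k \<Rightarrow> 'x"
  assumes od: "order_dense_sublattice (range J)" and dir: "directed_set \<Gamma> r"
    and uo: "uo_conv \<Gamma> r (\<lambda>\<alpha>. J (x \<alpha>)) 0"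
  shows "uo_conv \<Gamma> r x 0"
  unfolding uo_conv_zero_iff[OF dir]
proof (intro allI impI)
  fix z :: 'x assume "0 \<le> z"
  let ?F = "net_filter \<Gamma> r"
  let ?D = "{w. \<forall>\<^sub>F \<alpha> in ?F. inf \<bar>x \<alpha>\<bar> z \<le> w}"
  let ?E = "{w. \<forall>\<^sub>F \<alpha> in ?F. inf \<bar>J (x \<alpha>)\<bar> (J z) \<le> w}"
  have glb: "isGlb UNIV ?E 0"
    using uo \<open>0 \<le> z\<close> by (simp add: uo_conv_zero_iff[OF dir] J_nonneg_iff)
  have mem_iff: "w \<in> ?D \<longleftrightarrow> J w \<in> ?E" for w
    by (simp add: J_le_iff flip: J_abs J_inf)
  have greatest: "v \<le> 0" if v: "\<And>w. w \<in> ?D \<Longrightarrow> v \<le> w" for v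
  proof -
    have "J v \<le> w" if "w \<in> ?E" for w
    proof -
      have "isGlb UNIV {y \<in> range J. inf w (J z) \<le> y \<and> y \<le> J z} (inf w (J z))"
        by (rule order_dense_sublattice_isGlb[OF od]) auto
      moreover have "J v \<le> J y" if y: "inf w (J z) \<le> J y" for y
      proof -
        have "\<forall>\<^sub>F \<alpha> in ?F. inf \<bar>J (x \<alpha>)\<bar> (J z) \<le> J y"
          using \<open>w \<in> ?E\<close>[simplified]
          by (rule eventually_mono) (meson y inf.cobounded2 le_infI order_trans)
        then show ?thesis using v mem_iff by (simp add: J_le_iff)
      qed
      ultimately have "J v \<le> inf w (J z)" by (auto simp: isGlb_UNIV_iff)
      then show ?thesis by simp
    qed
    with glb have "J v \<le> 0" by (rule isGlb_UNIV_greatest)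
    then show ?thesis using J_le_iff[of v 0] by (simp add: J_simps)
  qed
  have lower: "0 \<le> w" if "w \<in> ?D" for w
  proof -
    have "J w \<in> ?E" using that mem_iff by blast
    with glb have "0 \<le> J w" by (rule isGlbD2)
    then show ?thesis by (simp add: J_nonneg_iff)
  qed
  show "isGlb UNIV ?D 0" by (rule isGlb_UNIV_I[OF lower greatest])
qed

text \<open>A downward directed set with infimum 0 is a uo-null net in \<open>X\<close>, hence in the completion;
  cutting it off at one of its own elements changes no tail and gives back order convergence.\<close>

lemma uo_conv_imp_regular:
  assumes uo: "\<And>(\<Gamma> :: ('i + 'x) set) r x. directed_set \<Gamma> r \<Longrightarrow> uo_conv \<Gamma> r x 0 \<Longrightarrow>
    uo_conv \<Gamma> r (\<lambda>\<alpha>. J (x \<alpha>)) 0"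
  shows "regular_sublattice (range J)"
proof (rule regular_sublatticeI)
  fix B :: "'x set"
  assume dir: "directed_set B (\<ge>)" and glb: "isGlb UNIV B 0"
  let ?\<Gamma> = "Inr ` B :: ('i + 'x) set" and ?r = "\<lambda>\<alpha> \<beta> :: 'i + 'x. projr \<alpha> \<ge> projr \<beta>"
  let ?F = "net_filter ?\<Gamma> ?r"
  have dir': "directed_set ?\<Gamma> ?r" by (rule directed_set_Inr[OF dir])
  have nonneg: "0 \<le> b" if "b \<in> B" for b
    using that glb by (auto simp: isGlb_UNIV_iff)
  have ev: "eventually P ?F \<longleftrightarrow> (\<exists>b\<in>B. \<forall>a\<in>B. a \<le> b \<longrightarrow> P (Inr a))" for P
    by (simp add: eventually_net_filter[OF dir'])
  have "uo_conv ?\<Gamma> ?r projr 0"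
    unfolding uo_conv_zero_iff[OF dir']
  proof (intro allI impI)
    fix z :: 'x assume "0 \<le> z"
    let ?D = "{w. \<forall>\<^sub>F \<alpha> in ?F. inf \<bar>projr \<alpha>\<bar> z \<le> w}"
    \<comment> \<open>Each \<open>b\<close> in \<open>B\<close> dominates the tail of the net that
      starts at \<open>b\<close>.\<close>
    have "B \<subseteq> ?D"
      using nonneg by (auto simp: ev abs_of_nonneg intro: le_infI1)
    moreover have "0 \<le> w" if w: "w \<in> ?D" for w
    proof -
      obtain b where "inf \<bar>b\<bar> z \<le> w" using w by (auto simp: ev)
      moreover have "0 \<le> inf \<bar>b\<bar> z" using \<open>0 \<le> z\<close> by simp
      ultimately show ?thesis by (rule order_trans[rotated])
    qed
    ultimately show "isGlb UNIV ?D 0" using glb unfolding isGlb_UNIV_iff by blast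
  qed
  from uo[OF dir' this] have uoJ: "uo_conv ?\<Gamma> ?r (\<lambda>\<alpha>. J (projr \<alpha>)) 0" .
  obtain b where b: "b \<in> B" using dir by (auto simp: directed_set_ge_iff)
  have glbJ: "isGlb UNIV {w. \<forall>\<^sub>F \<alpha> in ?F. inf \<bar>J (projr \<alpha>)\<bar> (J b) \<le> w} 0"
    using uoJ nonneg[OF b] by (simp add: uo_conv_zero_iff[OF dir'] J_nonneg_iff)
  have "v \<le> 0" if v: "\<And>a. a \<in> B \<Longrightarrow> v \<le> J a" for v
  proof -
    have "v \<le> w" if w: "\<forall>\<^sub>F \<alpha> in ?F. inf \<bar>J (projr \<alpha>)\<bar> (J b) \<le> w" for w
    proof -
      obtain c where c: "c \<in> B" "\<And>a. a \<in> B \<Longrightarrow> a \<le> c \<Longrightarrow> inf \<bar>J a\<bar> (J b) \<le> w"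
        using w by (auto simp: ev)
      \<comment> \<open>Below \<open>c\<close> the bound \<open>w\<close> is in force, and below
        \<open>b\<close> the truncation at \<open>J b\<close> has no effect.\<close>
      obtain a where a: "a \<in> B" "a \<le> c" "a \<le> b"
        using dir b c(1) by (auto simp: directed_set_ge_iff)
      have "inf \<bar>J a\<bar> (J b) = J a"
        using a nonneg by (simp add: abs_of_nonneg J_nonneg_iff inf.absorb1 J_le_iff)
      then show ?thesis using c(2)[of a] v[of a] a by simp
    qed
    then show ?thesis by (intro isGlb_UNIV_greatest[OF glbJ]) simp
  qed
  then show "isGlb UNIV (J ` B) 0"
    using nonneg by (auto simp: isGlb_UNIV_iff J_nonneg_iff)
qed

section \<open>Ideals and order completeness\<close>

text \<open>For \<open>0 \<le> z \<le> J u\<close>, the elements of \<open>X\<close> below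
  \<open>z\<close> have a supremum \<open>s\<close> in \<open>X\<close>. Order density makes
  \<open>z\<close> the supremum of their images and the infimum of the elements of
  \<open>range J\<close> in \<open>[z, J u]\<close>, so \<open>J s\<close> is squeezed onto
  \<open>z\<close>.\<close>

lemma order_dense_imp_order_ideal:
  assumes od: "order_dense_sublattice (range J)" and complete: "order_complete TYPE('x)"
  shows "order_ideal (range J)"
proof -
  have sub: "subspace (range J)"
    using vector_sublattice_range_J by (simp add: vector_sublattice_def)
  have below: "z \<in> range J" if "0 \<le> z" "z \<le> J u" for z u
  proof -
    let ?A = "{x. 0 \<le> x \<and> J x \<le> z}"
    have A_le: "x \<le> y" if "z \<le> J y" "x \<in> ?A" for x y
    proof -
      have "J x \<le> J y" using that by (auto intro: order_trans)
      then show ?thesis by (simp add: J_le_iff)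
    qed
    have bdd: "bdd_above ?A" using A_le[OF \<open>z \<le> J u\<close>] by (rule bdd_aboveI)
    have "0 \<in> ?A" using \<open>0 \<le> z\<close> by (simp add: J_simps)
    then have "?A \<noteq> {}" by blast
    from complete[unfolded order_complete_def, rule_format, OF this bdd]
    obtain s where s: "isLub UNIV ?A s" ..
    have "z \<le> J s"
    proof -
      have "y \<le> J s" if y: "y \<in> range J" "0 \<le> y" "y \<le> z" for y
      proof -
        obtain x where "y = J x" "x \<in> ?A" using y by (auto simp: J_nonneg_iff)
        then show ?thesis using isLubD2[OF s] by (simp add: J_le_iff)
      qed
      then show ?thesis
        by (intro isLub_UNIV_least[OF order_dense_sublattice_isLub[OF od \<open>0 \<le> z\<close>]]) auto
    qed
    moreover have "J s \<le> z"
    proof -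
      have "J s \<le> J y" if "z \<le> J y" for y
        unfolding J_le_iff using s A_le[OF that] by (rule isLub_UNIV_least)
      then show ?thesis
        by (intro isGlb_UNIV_greatest[OF order_dense_sublattice_isGlb[OF od rangeI \<open>z \<le> J u\<close>]])
          auto
    qed
    ultimately show ?thesis by (metis antisym rangeI)
  qed
  have "z \<in> range J" if z: "\<bar>z\<bar> \<le> \<bar>J x\<bar>" for z x
  proof -
    \<comment> \<open>A general \<open>z\<close> is the difference of its positive part
      \<open>pprt z\<close> and its negative part \<open>- nprt z\<close>; both fall under the case
      of positive elements.\<close>
    have "pprt z \<le> \<bar>z\<bar>" "- nprt z \<le> \<bar>z\<bar>" by (simp_all add: abs_prts)
    then have "pprt z \<in> range J" "- nprt z \<in> range J"
      using z by (auto intro!: below[of _ "\<bar>x\<bar>"] simp: J_abs)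
    then have "pprt z - (- nprt z) \<in> range J" using sub by (intro subspace_diff)
    then show ?thesis using prts[of z] by simp
  qed
  then show ?thesis using sub by (auto simp: order_ideal_def)
qed

text \<open>Cutting \<open>z\<close> by a close \<open>J x\<close> stays in the ideal. The result is
  no farther from \<open>z\<close> than \<open>J x\<close>, hence at distance less than
  \<open>norm z\<close>, and so it is nonzero.\<close>

lemma order_ideal_imp_order_dense:
  assumes "order_ideal (range J)"
  shows "order_dense_sublattice (range J)"
  unfolding order_dense_sublattice_def
proof (intro conjI allI impI vector_sublattice_range_J)
  fix z :: 'z assume z: "0 < z"
  then obtain x where x: "0 \<le> x" "norm (z - J x) < norm z"
    using J_approx_nonneg[of z "norm z"] by (auto simp: less_imp_le)
  define y where "y = inf z (J x)"
  have "0 \<le> y" using x z by (simp add: y_def J_nonneg_iff less_imp_le)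
  then have "\<bar>y\<bar> \<le> \<bar>J x\<bar>" using x by (simp add: abs_of_nonneg J_nonneg_iff y_def)
  then have "y \<in> range J" using assms by (auto simp: order_ideal_def)
  moreover have "norm (z - y) < norm z"
  proof -
    have "\<bar>z - y\<bar> \<le> \<bar>z - J x\<bar>" using abs_diff_inf_le[of z z "J x"] by (simp add: y_def)
    then show ?thesis using norm_mono_abs x(2) by (metis order_le_less_trans)
  qed
  then have "y \<noteq> 0" by auto
  then have "0 < y" using \<open>0 \<le> y\<close> by simp
  moreover have "y \<le> z" by (simp add: y_def)
  ultimately show "\<exists>y\<in>range J. 0 < y \<and> y \<le> z" by blast
qed

end

theorem theorem4p1:
  fixes x0 :: "'x::archimedean_vector_lattice \<Rightarrow> real"
    and J :: "'x \<Rightarrow> 'z::banach_lattice"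
  assumes "linear x0"
    and "strictly_positive x0"
    and "norm_completion (L_norm x0) J"
  shows "(order_continuous TYPE('i + 'x) x0 \<longleftrightarrow> regular_sublattice (range J)) \<and>
         (regular_sublattice (range J) \<longleftrightarrow> order_dense_sublattice (range J)) \<and>
         (order_dense_sublattice (range J) \<longleftrightarrow>
            (\<forall>(\<Gamma> :: ('i + 'x) set) r x. directed_set \<Gamma> r \<longrightarrow>
               (uo_conv \<Gamma> r x 0 \<longleftrightarrow> uo_conv \<Gamma> r (\<lambda>\<alpha>. J (x \<alpha>)) 0))) \<and>
         (order_complete TYPE('x) \<longrightarrow>
            (order_continuous TYPE('i + 'x) x0 \<longleftrightarrow> order_ideal (range J)))"
proof -
  interpret L_completion x0 J by (rule L_completion.intro) (fact assms)+
  let ?oc = "order_continuous TYPE('i + 'x) x0"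
  let ?reg = "regular_sublattice (range J)"
  let ?od = "order_dense_sublattice (range J)"
  let ?uo = "\<forall>(\<Gamma> :: ('i + 'x) set) r x. directed_set \<Gamma> r \<longrightarrow>
    (uo_conv \<Gamma> r x 0 \<longleftrightarrow> uo_conv \<Gamma> r (\<lambda>\<alpha>. J (x \<alpha>)) 0)"
  have oc_reg: "?oc \<longleftrightarrow> ?reg"
    using order_continuous_imp_regular regular_imp_order_continuous by blast
  \<comment> \<open>Regularity reaches order density by way of order continuity.\<close>
  have reg_od: "?reg \<longleftrightarrow> ?od"
    using oc_reg order_continuous_imp_order_dense order_dense_imp_regular by blast
  have "?od \<longleftrightarrow> ?uo"
  proof
    show ?uo if ?od
      using that reg_od regular_imp_uo_conv order_dense_imp_uo_conv by blast
    show ?od if ?uo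
      using that reg_od uo_conv_imp_regular by blast
  qed
  moreover have "?oc \<longleftrightarrow> order_ideal (range J)" if "order_complete TYPE('x)"
    using that oc_reg reg_od order_dense_imp_order_ideal order_ideal_imp_order_dense by blast
  ultimately show ?thesis using oc_reg reg_od by blast
qed

end
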